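(* Let $X$ be a real normed linear space with unit sphere $S_X$, and let \begin{align*} DW_1(X) & :=\sup\left\{\frac{(\lambda+\mu)\|u+v\|}{\|\lambda u+\mu v\|}: u,v\in S_X,\ 0<\lambda<\mu\right\},\\ DW_2(X) & := \sup\left\{\frac{\|u+v\|}{\|\gamma u+(1-\gamma) v\|}: u,v\in S_X,\ 0<\gamma<\tfrac{1}{2}\right\},\\ DW_3(X) & := \sup\left\{\frac{\|u+v\|}{\inf_{0<\gamma<\frac{1}{2}}\|\gamma u+(1-\gamma) v\|}: u,v\in S_X,\ u+v\neq0 \right\},\\ DW_4(X) & := \sup\left\{\frac{2\|u+v\|}{\|u+v+\delta (u-v)\|}: u,v\in S_X,\ 0<\delta<1\right\},\\ DW_5(X) & := \sup\left\{\frac{(1+t)\|u+v\|}{\|u+tv\|}: u,v\in S_X,\ 0<t<1\right\}. \end{align*} Then $DW(X)=DW_i(X)$ for every $i=1,\ldots,5$, where $DW(X)$ is the Dunkl--Williams constant of $X$.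
   Context: For a real normed linear space $X$, $S_X=\{x\in X:\|x\|=1\}$ denotes its unit sphere. The Dunkl--Williams constant of $X$ is $$DW(X)=\sup\left\{\frac{\|x\|+\|y\|}{\|x-y\|}\left\|\frac{x}{\|x\|}-\frac{y}{\|y\|}\right\|:\ x,y\in X\setminus\{0\},\ x\neq y\right\}.$$ *)

theory Defs
  imports "HOL-Analysis.Analysis"
begin

text \<open>
  The suprema are taken in \<^typ>\<open>ereal\<close>, so that they are genuine least upper bounds without
  a boundedness side condition. In a space consisting of zero only, every set below is empty and
  all the constants are \<open>-\<infinity>\<close>. All denominators occurring below are nonzero, since
  \<open>norm (a *\<^sub>R u + b *\<^sub>R v) \<ge> b - a\<close> for unit vectors \<open>u\<close>, \<open>v\<close> and \<open>0 < a < b\<close>; for \<open>DW3\<close>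
  the condition \<open>u + v \<noteq> 0\<close> makes the infimum positive.
\<close>

definition DW :: "'a::real_normed_vector itself \<Rightarrow> ereal" where
  "DW (_ :: 'a itself) =
     Sup {ereal ((norm x + norm y) / norm (x - y) * norm (x /\<^sub>R norm x - y /\<^sub>R norm y)) | x y :: 'a.
            x \<noteq> 0 \<and> y \<noteq> 0 \<and> x \<noteq> y}"

definition DW1 :: "'a::real_normed_vector itself \<Rightarrow> ereal" where
  "DW1 (_ :: 'a itself) =
     Sup {ereal ((l + m) * norm (u + v) / norm (l *\<^sub>R u + m *\<^sub>R v)) | (u :: 'a) (v :: 'a) (l :: real) (m :: real).
            u \<in> sphere 0 1 \<and> v \<in> sphere 0 1 \<and> 0 < l \<and> l < m}"

definition DW2 :: "'a::real_normed_vector itself \<Rightarrow> ereal" where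
  "DW2 (_ :: 'a itself) =
     Sup {ereal (norm (u + v) / norm (c *\<^sub>R u + (1 - c) *\<^sub>R v)) | (u :: 'a) (v :: 'a) (c :: real).
            u \<in> sphere 0 1 \<and> v \<in> sphere 0 1 \<and> 0 < c \<and> c < 1 / 2}"

definition DW3 :: "'a::real_normed_vector itself \<Rightarrow> ereal" where
  "DW3 (_ :: 'a itself) =
     Sup {ereal (norm (u + v) / (INF c\<in>{0<..<1/2 :: real}. norm (c *\<^sub>R u + (1 - c) *\<^sub>R v))) | (u :: 'a) (v :: 'a).
            u \<in> sphere 0 1 \<and> v \<in> sphere 0 1 \<and> u + v \<noteq> 0}"

definition DW4 :: "'a::real_normed_vector itself \<Rightarrow> ereal" where
  "DW4 (_ :: 'a itself) =
     Sup {ereal (2 * norm (u + v) / norm (u + v + d *\<^sub>R (u - v))) | (u :: 'a) (v :: 'a) (d :: real).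
            u \<in> sphere 0 1 \<and> v \<in> sphere 0 1 \<and> 0 < d \<and> d < 1}"

definition DW5 :: "'a::real_normed_vector itself \<Rightarrow> ereal" where
  "DW5 (_ :: 'a itself) =
     Sup {ereal ((1 + t) * norm (u + v) / norm (u + t *\<^sub>R v)) | (u :: 'a) (v :: 'a) (t :: real).
            u \<in> sphere 0 1 \<and> v \<in> sphere 0 1 \<and> 0 < t \<and> t < 1}"

end

theory Submission
  imports Defs
begin

text \<open>
  For \<open>x = l u\<close> and \<open>y = - m v\<close> with \<open>u\<close>, \<open>v\<close> unit vectors, the Dunkl--Williams quotient becomes
  \<open>(l + m) \<parallel>u + v\<parallel> / \<parallel>l u + m v\<parallel>\<close>. It is symmetric and homogeneous of degree zero in \<open>(l, m)\<close>, and
  equals 2 (or the junk value 0) on the diagonal \<open>l = m\<close>, a value also attained off the diagonal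
  at \<open>u = v\<close>. Hence \<open>l < m\<close> may be assumed, and the constants other than \<open>DW3\<close> correspond to the
  normalisations \<open>l + m = 1\<close>, \<open>l + m = 2\<close> and \<open>m = 1\<close>. All equalities are obtained by showing that
  the constants have the same real upper bounds.
\<close>

text \<open>One version for each number of variables bound in the set comprehensions: the pattern is
  syntactic, so two, three and four variables are treated separately.\<close>

lemma Sup_ereal_le_iff:
  "Sup {ereal (f u v) | u v. P u v} \<le> ereal B \<longleftrightarrow> (\<forall>u v. P u v \<longrightarrow> f u v \<le> B)"
  "Sup {ereal (g u v c) | u v c. Q u v c} \<le> ereal B \<longleftrightarrow> (\<forall>u v c. Q u v c \<longrightarrow> g u v c \<le> B)"
  "Sup {ereal (h u v l m) | u v l m. R u v l m} \<le> ereal B \<longleftrightarrow>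
    (\<forall>u v l m. R u v l m \<longrightarrow> h u v l m \<le> B)"
  unfolding Sup_le_iff Ball_def mem_Collect_eq ereal_less_eq(3)[symmetric] by blast+

section \<open>The weighted quotient and its symmetries\<close>

definition dw_quot :: "'a::real_normed_vector \<Rightarrow> 'a \<Rightarrow> real \<Rightarrow> real \<Rightarrow> real" where
  "dw_quot u v l m = (l + m) * norm (u + v) / norm (l *\<^sub>R u + m *\<^sub>R v)"

text \<open>Common normal form for the real upper bounds of all six constants. On the zero space it
  holds for every \<open>B\<close>, in agreement with suprema equal to -\<infinity>.\<close>

definition dw_bound :: "'a::real_normed_vector itself \<Rightarrow> real \<Rightarrow> bool" where
  "dw_bound (_ :: 'a itself) B \<longleftrightarrow>
     (\<forall>(u :: 'a) v l m. norm u = 1 \<longrightarrow> norm v = 1 \<longrightarrow> 0 < l \<longrightarrow> l < m \<longrightarrow> dw_quot u v l m \<le> B)"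

lemma dw_quot_commute: "dw_quot u v l m = dw_quot v u m l"
  by (simp add: dw_quot_def add.commute)

lemma dw_quot_scale:
  assumes "k > 0"
  shows "dw_quot u v (k * l) (k * m) = dw_quot u v l m"
proof -
  have "(k * l) *\<^sub>R u + (k * m) *\<^sub>R v = k *\<^sub>R (l *\<^sub>R u + m *\<^sub>R v)"
    by (simp add: scaleR_add_right)
  then have "norm ((k * l) *\<^sub>R u + (k * m) *\<^sub>R v) = k * norm (l *\<^sub>R u + m *\<^sub>R v)"
    using assms by simp
  moreover have "k * l + k * m = k * (l + m)"
    by (simp add: distrib_left)
  ultimately show ?thesis
    using assms by (simp add: dw_quot_def mult.assoc)
qed

lemma dw_quot_same:
  assumes "norm u = 1" "0 < l" "0 < m"
  shows "dw_quot u u l m = 2"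
proof -
  have "norm (u + u) = 2"
    using assms by (simp flip: scaleR_2)
  moreover have "norm (l *\<^sub>R u + m *\<^sub>R u) = l + m"
    using assms by (simp flip: scaleR_add_left)
  ultimately show ?thesis
    using assms by (simp add: dw_quot_def divide_simps)
qed

text \<open>Only an inequality is available: cancelling \<open>l * norm (u + v)\<close> gives 2 if
  \<open>u + v\<close> is nonzero, while for \<open>v = - u\<close> division by zero yields
  0.\<close>

lemma dw_quot_diag_le:
  assumes "0 < l"
  shows "dw_quot u v l l \<le> 2"
proof -
  have "norm (l *\<^sub>R u + l *\<^sub>R v) = l * norm (u + v)"
    using assms by (simp flip: scaleR_add_right)
  then show ?thesis
    using assms by (simp add: dw_quot_def)
qed

text \<open>Swapping the vectors together with their weights reduces \<open>m < l\<close> to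
  \<open>l < m\<close>; the diagonal needs only \<open>2 \<le> B\<close>.\<close>

lemma dw_boundD:
  assumes "dw_bound TYPE('a) B" "norm (u :: 'a::real_normed_vector) = 1" "norm v = 1"
    and "0 < l" "0 < m"
  shows "dw_quot u v l m \<le> B"
proof -
  consider "l < m" | "m < l" | "l = m" by linarith
  then show ?thesis
  proof cases
    case 1
    then show ?thesis using assms by (auto simp: dw_bound_def)
  next
    case 2
    then have "dw_quot v u m l \<le> B"
      using assms by (auto simp: dw_bound_def)
    then show ?thesis by (simp add: dw_quot_commute[of u])
  next
    case 3
    \<comment> \<open>Equal vectors give the value 2 at any positive weights; 1 and 2 are just an
      admissible off-diagonal choice.\<close>
    have "dw_quot u u 1 2 \<le> B"
      using assms(1,2) by (auto simp: dw_bound_def)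
    with dw_quot_same[OF assms(2), of 1 2] have "2 \<le> B" by simp
    with dw_quot_diag_le[OF \<open>0 < l\<close>, of u v] 3 show ?thesis by simp
  qed
qed

text \<open>Makes the infimum in \<open>DW3\<close> positive. With \<open>w\<close> the convex
  combination, \<open>u + v = 2 w + (1 - 2 c) (u - v)\<close>; here
  \<open>norm (u - v) \<le> 2\<close> and \<open>1 - 2 c \<le> norm w\<close>, so each summand has
  norm at most \<open>2 * norm w\<close>.\<close>

lemma norm_add_le_4_norm_combination:
  fixes u v :: "'a::real_normed_vector"
  assumes "norm u = 1" "norm v = 1" "0 < c" "c < 1 / 2"
  shows "norm (u + v) \<le> 4 * norm (c *\<^sub>R u + (1 - c) *\<^sub>R v)"
proof -
  let ?w = "c *\<^sub>R u + (1 - c) *\<^sub>R v"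
  have "(1 - c) *\<^sub>R v = ?w - c *\<^sub>R u"
    by simp
  then have "norm ((1 - c) *\<^sub>R v) \<le> norm ?w + norm (c *\<^sub>R u)"
    by (metis norm_triangle_ineq4)
  then have "1 - 2 * c \<le> norm ?w"
    using assms by simp
  moreover have "u + v = 2 *\<^sub>R ?w + (1 - 2 * c) *\<^sub>R (u - v)"
    by (simp add: algebra_simps scaleR_2)
  then have "norm (u + v) \<le> norm (2 *\<^sub>R ?w) + norm ((1 - 2 * c) *\<^sub>R (u - v))"
    by (metis norm_triangle_ineq)
  moreover have "norm ((1 - 2 * c) *\<^sub>R (u - v)) \<le> (1 - 2 * c) * 2"
  proof -
    have "norm (u - v) \<le> 2"
      using norm_triangle_ineq4[of u v] assms by simp
    then show ?thesis
      using assms mult_left_mono[of "norm (u - v)" 2 "1 - 2 * c"] by simp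
  qed
  ultimately show ?thesis by simp
qed

section \<open>Real upper bounds of the six constants\<close>

lemma DW_le_iff: "DW TYPE('a::real_normed_vector) \<le> ereal B \<longleftrightarrow> dw_bound TYPE('a) B"
proof
  assume le: "DW TYPE('a) \<le> ereal B"
  show "dw_bound TYPE('a) B"
    unfolding dw_bound_def
  proof (intro allI impI)
    fix u v :: 'a and l m :: real
    assume uv: "norm u = 1" "norm v = 1" and lm: "0 < l" "l < m"
    let ?x = "l *\<^sub>R u" and ?y = "- (m *\<^sub>R v)"
    have nx: "norm ?x = l" and ny: "norm ?y = m"
      using uv lm by simp_all
    \<comment> \<open>The vectors differ because their norms \<open>l < m\<close> do.\<close>
    then have ne: "?x \<noteq> 0" "?y \<noteq> 0" "?x \<noteq> ?y"
      using lm by (auto dest: arg_cong[of _ _ norm])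
    have "ereal ((norm ?x + norm ?y) / norm (?x - ?y) * norm (?x /\<^sub>R norm ?x - ?y /\<^sub>R norm ?y))
        \<le> DW TYPE('a)"
      unfolding DW_def by (rule Sup_upper) (use ne in blast)
    moreover have "?x /\<^sub>R norm ?x - ?y /\<^sub>R norm ?y = u + v"
      unfolding nx ny using lm by simp
    ultimately have "ereal (dw_quot u v l m) \<le> DW TYPE('a)"
      unfolding nx ny by (simp add: dw_quot_def)
    from order_trans[OF this le] show "dw_quot u v l m \<le> B"
      by simp
  qed
next
  assume B: "dw_bound TYPE('a) B"
  show "DW TYPE('a) \<le> ereal B"
    unfolding DW_def
  proof (rule Sup_least, clarsimp)
    fix x y :: 'a
    assume ne: "x \<noteq> 0" "y \<noteq> 0"
    define u v where "u = x /\<^sub>R norm x" and "v = - (y /\<^sub>R norm y)"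
    have "norm u = 1" "norm v = 1"
      using ne by (simp_all add: u_def v_def)
    \<comment> \<open>The norms of \<open>x\<close> and \<open>y\<close> may come in either order or
      coincide, so the bound for arbitrary positive weights is used.\<close>
    then have "dw_quot u v (norm x) (norm y) \<le> B"
      using dw_boundD[OF B] ne by simp
    moreover have "norm x *\<^sub>R u + norm y *\<^sub>R v = x - y" "u + v = x /\<^sub>R norm x - y /\<^sub>R norm y"
      using ne by (simp_all add: u_def v_def)
    ultimately show "(norm x + norm y) * norm (x /\<^sub>R norm x - y /\<^sub>R norm y) / norm (x - y) \<le> B"
      by (simp add: dw_quot_def)
  qed
qed

lemma DW1_le_iff: "DW1 TYPE('a::real_normed_vector) \<le> ereal B \<longleftrightarrow> dw_bound TYPE('a) B"
  unfolding DW1_def dw_bound_def dw_quot_def Sup_ereal_le_iff by (simp, blast)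

lemma DW2_le_iff: "DW2 TYPE('a::real_normed_vector) \<le> ereal B \<longleftrightarrow> dw_bound TYPE('a) B"
proof -
  have "DW2 TYPE('a) \<le> ereal B \<longleftrightarrow>
      (\<forall>(u :: 'a) v c. norm u = 1 \<longrightarrow> norm v = 1 \<longrightarrow> 0 < c \<longrightarrow> c < 1/2 \<longrightarrow> dw_quot u v c (1 - c) \<le> B)"
    unfolding DW2_def dw_quot_def Sup_ereal_le_iff by (simp, blast)
  also have "\<dots> \<longleftrightarrow> dw_bound TYPE('a) B"
  proof
    assume *: "\<forall>(u :: 'a) v c. norm u = 1 \<longrightarrow> norm v = 1 \<longrightarrow> 0 < c \<longrightarrow> c < 1/2
      \<longrightarrow> dw_quot u v c (1 - c) \<le> B"
    show "dw_bound TYPE('a) B"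
      unfolding dw_bound_def
    proof (intro allI impI)
      fix u v :: 'a and l m :: real
      assume uv: "norm u = 1" "norm v = 1" and lm: "0 < l" "l < m"
      \<comment> \<open>Rescaling the weights to sum 1; \<open>l < m\<close> puts the first one
        below 1/2.\<close>
      have "dw_quot u v (l / (l + m)) (1 - l / (l + m)) \<le> B"
        by (intro *[rule_format] uv) (use lm in \<open>simp_all add: field_simps\<close>)
      moreover have "1 - l / (l + m) = m / (l + m)"
        using lm by (simp add: field_simps)
      ultimately show "dw_quot u v l m \<le> B"
        using dw_quot_scale[of "1 / (l + m)" u v l m] lm by simp
    qed
  qed (auto simp: dw_bound_def)
  finally show ?thesis .
qed

text \<open>Compared with \<open>DW2\<close>: for fixed \<open>u\<close>, \<open>v\<close> with
  nonzero sum, the supremum over \<open>c\<close> of the quotients is the quotient by the infimum,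
  as that infimum is positive.\<close>

lemma DW3_le_iff: "DW3 TYPE('a::real_normed_vector) \<le> ereal B \<longleftrightarrow> dw_bound TYPE('a) B"
proof -
  define N where "N = (\<lambda>(u :: 'a) v. INF c\<in>{0<..<1/2 :: real}. norm (c *\<^sub>R u + (1 - c) *\<^sub>R v))"
  have N_le: "N u v \<le> norm (c *\<^sub>R u + (1 - c) *\<^sub>R v)" if "0 < c" "c < 1/2" for u v c
    unfolding N_def by (rule cINF_lower) (use that in \<open>auto intro: bdd_belowI2[where m=0]\<close>)
  have le_N: "z \<le> N u v" if "\<And>c. 0 < c \<Longrightarrow> c < 1/2 \<Longrightarrow> z \<le> norm (c *\<^sub>R u + (1 - c) *\<^sub>R v)" for u v z
    unfolding N_def
  proof (rule cINF_greatest)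
    show "{0<..<1/2 :: real} \<noteq> {}" by simp
  qed (use that in auto)
  have N_pos: "0 < N u v" if "norm u = 1" "norm v = 1" "u + v \<noteq> 0" for u v
  proof -
    have "norm (u + v) / 4 \<le> N u v"
    proof (rule le_N)
      fix c :: real assume "0 < c" "c < 1/2"
      then show "norm (u + v) / 4 \<le> norm (c *\<^sub>R u + (1 - c) *\<^sub>R v)"
        using norm_add_le_4_norm_combination[OF that(1,2), of c] by simp
    qed
    moreover have "0 < norm (u + v) / 4"
      using that by simp
    ultimately show ?thesis by linarith
  qed
  have DW3_iff: "DW3 TYPE('a) \<le> ereal B \<longleftrightarrow>
      (\<forall>u v. norm u = 1 \<longrightarrow> norm v = 1 \<longrightarrow> u + v \<noteq> 0 \<longrightarrow> norm (u + v) / N u v \<le> B)"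
    unfolding DW3_def N_def Sup_ereal_le_iff by (simp, blast)
  have DW2_iff: "DW2 TYPE('a) \<le> ereal B \<longleftrightarrow> (\<forall>(u :: 'a) v c. norm u = 1 \<longrightarrow> norm v = 1 \<longrightarrow>
      0 < c \<longrightarrow> c < 1/2 \<longrightarrow> norm (u + v) / norm (c *\<^sub>R u + (1 - c) *\<^sub>R v) \<le> B)"
    unfolding DW2_def Sup_ereal_le_iff by (simp, blast)
  have "DW3 TYPE('a) \<le> ereal B \<longleftrightarrow> DW2 TYPE('a) \<le> ereal B"
  proof
    assume *: "DW3 TYPE('a) \<le> ereal B"
    show "DW2 TYPE('a) \<le> ereal B"
      unfolding DW2_iff
    proof (intro allI impI)
      fix u v :: 'a and c :: real
      assume uv: "norm u = 1" "norm v = 1" and c: "0 < c" "c < 1/2"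
      show "norm (u + v) / norm (c *\<^sub>R u + (1 - c) *\<^sub>R v) \<le> B"
      proof (cases "u + v = 0")
        case True
        \<comment> \<open>The pair with \<open>v = - u\<close> is absent from \<open>DW3\<close>.
          Its quotient is 0, and \<open>0 \<le> B\<close> follows from the admissible pair
          \<open>u\<close>, \<open>u\<close>.\<close>
        have "u + u \<noteq> 0"
          using uv by (metis norm_zero scaleR_2 scaleR_eq_0_iff zero_neq_numeral zero_neq_one)
        then have "norm (u + u) / N u u \<le> B"
          using * uv unfolding DW3_iff by blast
        moreover have "0 \<le> norm (u + u) / N u u"
          using N_pos[OF uv(1) uv(1) \<open>u + u \<noteq> 0\<close>] by simp
        ultimately show ?thesis using True by simp
      next
        case False
        have "norm (u + v) / norm (c *\<^sub>R u + (1 - c) *\<^sub>R v) \<le> norm (u + v) / N u v"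
          using N_pos[OF uv False] N_le[OF c, of u v] by (intro frac_le) auto
        also have "\<dots> \<le> B"
          using * uv False unfolding DW3_iff by blast
        finally show ?thesis .
      qed
    qed
  next
    assume *: "DW2 TYPE('a) \<le> ereal B"
    show "DW3 TYPE('a) \<le> ereal B"
      unfolding DW3_iff
    proof (intro allI impI)
      fix u v :: 'a
      assume uv: "norm u = 1" "norm v = 1" and nz: "u + v \<noteq> 0"
      have bound: "norm (u + v) \<le> B * norm (c *\<^sub>R u + (1 - c) *\<^sub>R v)"
        and pos: "0 < norm (c *\<^sub>R u + (1 - c) *\<^sub>R v)" if "0 < c" "c < 1/2" for c
      proof -
        show "0 < norm (c *\<^sub>R u + (1 - c) *\<^sub>R v)"
          using N_pos[OF uv nz] N_le[OF that, of u v] by linarith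
        moreover have "norm (u + v) / norm (c *\<^sub>R u + (1 - c) *\<^sub>R v) \<le> B"
          using * uv that unfolding DW2_iff by blast
        ultimately show "norm (u + v) \<le> B * norm (c *\<^sub>R u + (1 - c) *\<^sub>R v)"
          by (simp add: pos_divide_le_eq)
      qed
      \<comment> \<open>Sampling at \<open>c = 1/4\<close> shows that \<open>B\<close> is positive.
        Dividing by \<open>B\<close> then makes \<open>norm (u + v) / B\<close> a lower bound for
        every combination, hence for the infimum.\<close>
      have "0 < B * norm ((1/4) *\<^sub>R u + (1 - 1/4) *\<^sub>R v)"
        using order_less_le_trans[OF _ bound[of "1/4"]] nz by simp
      then have "0 < B"
        using pos[of "1/4"] by (simp add: zero_less_mult_iff)
      then have "norm (u + v) / B \<le> N u v"
        by (intro le_N) (simp add: bound pos_divide_le_eq mult.commute)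
      then show "norm (u + v) / N u v \<le> B"
        using \<open>0 < B\<close> N_pos[OF uv nz] by (simp add: field_simps)
    qed
  qed
  then show ?thesis
    by (simp add: DW2_le_iff)
qed

lemma DW4_le_iff: "DW4 TYPE('a::real_normed_vector) \<le> ereal B \<longleftrightarrow> dw_bound TYPE('a) B"
proof -
  \<comment> \<open>The vectors are swapped because \<open>u\<close> carries the larger weight
    \<open>1 + d\<close>; the weights sum to 2.\<close>
  have "dw_quot v u (1 - d) (1 + d) = 2 * norm (u + v) / norm (u + v + d *\<^sub>R (u - v))"
    for u v :: 'a and d
    by (simp add: dw_quot_def algebra_simps)
  then have "DW4 TYPE('a) \<le> ereal B \<longleftrightarrow>
      (\<forall>(u :: 'a) v d. norm u = 1 \<longrightarrow> norm v = 1 \<longrightarrow> 0 < d \<longrightarrow> d < 1 \<longrightarrow> dw_quot v u (1 - d) (1 + d) \<le> B)"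
    unfolding DW4_def Sup_ereal_le_iff by (simp, blast)
  also have "\<dots> \<longleftrightarrow> dw_bound TYPE('a) B"
  proof
    assume *: "\<forall>(u :: 'a) v d. norm u = 1 \<longrightarrow> norm v = 1 \<longrightarrow> 0 < d \<longrightarrow> d < 1
      \<longrightarrow> dw_quot v u (1 - d) (1 + d) \<le> B"
    show "dw_bound TYPE('a) B"
      unfolding dw_bound_def
    proof (intro allI impI)
      fix u v :: 'a and l m :: real
      assume uv: "norm u = 1" "norm v = 1" and lm: "0 < l" "l < m"
      \<comment> \<open>The solution of \<open>(1 - d) / (1 + d) = l / m\<close>.\<close>
      define d where "d = (m - l) / (l + m)"
      have "0 < d" "d < 1"
        using lm by (simp_all add: d_def field_simps)
      with * uv have "dw_quot u v (1 - d) (1 + d) \<le> B"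
        by blast
      moreover have "1 - d = 2 / (l + m) * l" "1 + d = 2 / (l + m) * m"
        using lm by (simp_all add: d_def field_simps)
      ultimately show "dw_quot u v l m \<le> B"
        using dw_quot_scale[of "2 / (l + m)" u v l m] lm by simp
    qed
  qed (auto simp: dw_bound_def)
  finally show ?thesis .
qed

lemma DW5_le_iff: "DW5 TYPE('a::real_normed_vector) \<le> ereal B \<longleftrightarrow> dw_bound TYPE('a) B"
proof -
  \<comment> \<open>Swapped again, so that the larger weight 1 stands last.\<close>
  have "dw_quot v u t 1 = (1 + t) * norm (u + v) / norm (u + t *\<^sub>R v)" for u v :: 'a and t
    by (simp add: dw_quot_def add.commute)
  then have "DW5 TYPE('a) \<le> ereal B \<longleftrightarrow>
      (\<forall>(u :: 'a) v t. norm u = 1 \<longrightarrow> norm v = 1 \<longrightarrow> 0 < t \<longrightarrow> t < 1 \<longrightarrow> dw_quot v u t 1 \<le> B)"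
    unfolding DW5_def Sup_ereal_le_iff by (simp, blast)
  also have "\<dots> \<longleftrightarrow> dw_bound TYPE('a) B"
  proof
    assume *: "\<forall>(u :: 'a) v t. norm u = 1 \<longrightarrow> norm v = 1 \<longrightarrow> 0 < t \<longrightarrow> t < 1
      \<longrightarrow> dw_quot v u t 1 \<le> B"
    show "dw_bound TYPE('a) B"
      unfolding dw_bound_def
    proof (intro allI impI)
      fix u v :: 'a and l m :: real
      assume uv: "norm u = 1" "norm v = 1" and lm: "0 < l" "l < m"
      have "dw_quot u v (l / m) 1 \<le> B"
        using * uv lm by simp
      then show "dw_quot u v l m \<le> B"
        using dw_quot_scale[of "1 / m" u v l m] lm by simp
    qed
  qed (auto simp: dw_bound_def)
  finally show ?thesis .
qed

text \<open>An extended real is the infimum of the reals above it: \<infinity> has none and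
  -\<infinity> has all of them. Finiteness of the suprema therefore never has to be
  discussed.\<close>

lemma ereal_eqI_real_upper_bounds:
  fixes x y :: ereal
  assumes "\<And>B. x \<le> ereal B \<longleftrightarrow> y \<le> ereal B"
  shows "x = y"
  proof (rule antisym)
  show "x \<le> y"
    by (rule ereal_le_real) (use assms in simp)
  show "y \<le> x"
    by (rule ereal_le_real) (use assms in simp)
qed

theorem proposition1:
  shows "DW TYPE('a::real_normed_vector) = DW1 TYPE('a)
    \<and> DW TYPE('a) = DW2 TYPE('a)
    \<and> DW TYPE('a) = DW3 TYPE('a)
    \<and> DW TYPE('a) = DW4 TYPE('a)
    \<and> DW TYPE('a) = DW5 TYPE('a)"
  by (intro conjI ereal_eqI_real_upper_bounds)
    (simp_all add: DW_le_iff DW1_le_iff DW2_le_iff DW3_le_iff DW4_le_iff DW5_le_iff)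

end
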